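(* Suppose that $d_2>d_1=1$. Then there exists a constant $N>0$ such that for every $a\in\mathbb{R}$ with $|a|>N$ and $a h(x)>0$ for all $x\in[0,b]$, the set $$\Lambda_a=\{x\in\mathbb{R}:\ f_a^k(x)\in[0,b]\ \text{for all}\ k\ge0\}$$ is an invariant set for $f_a$ such that $f_a:\Lambda_a\to\Lambda_a$ is topologically semiconjugate to $\sigma:\Sigma_2\to\Sigma_2$, but $f_a$ is not hyperbolic on $\Lambda_a$.
   Context: Let $g$ be a monic real-coefficient polynomial having $0$ as a zero of multiplicity $d_1\ge1$, and having at least one positive real zero; let $b>0$ be the smallest positive real zero of $g$, with multiplicity $d_2\ge1$. Write $g(x)=x^{d_1}(b-x)^{d_2}h(x)$, where $h$ is a real polynomial with no zeros in $[0,b]$. For a real parameter $a$ let $f_a(x)=a g(x)=a x^{d_1}(b-x)^{d_2}h(x)$; the parameter is assumed to satisfy $a h(x)>0$ for all $x\in[0,b]$. $f_a^k$ denotes the $k$-fold iterate of $f_a$. A set $\Lambda$ is invariant for $f$ if $f(\Lambda)=\Lambda$. For a $C^1$ map $f:\mathbb{R}\to\mathbb{R}$, a compact invariant set $\Lambda$ is a hyperbolic set for $f$ (equivalently, $f$ is hyperbolic on $\Lambda$) if there are constants $C>0$ and $\lambda>1$ such that $|(f^n)'(x)|\ge C\lambda^n$ for all $x\in\Lambda$ and all $n\ge1$. $\Sigma_2=\{(s_0,s_1,s_2,\dots): s_i\in\{1,2\}\}$ is the one-sided sequence space on two symbols with the metric $d(s,t)=\sum_{i\ge0}\delta(s_i,t_i)/2^i$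 ($\delta(s_i,t_i)=1$ if $s_i\ne t_i$ and $0$ otherwise), and $\sigma(s_0,s_1,s_2,\dots)=(s_1,s_2,\dots)$ is the shift map. "$f_a:\Lambda_a\to\Lambda_a$ is topologically semiconjugate to $\sigma:\Sigma_2\to\Sigma_2$" means that there is a continuous surjection $\phi:\Lambda_a\to\Sigma_2$ with $\phi\circ f_a=\sigma\circ\phi$. *)

theory Defs
  imports "HOL-Analysis.Analysis" "HOL-Computational_Algebra.Computational_Algebra"
begin

definition invariant_set :: "('a \<Rightarrow> 'a) \<Rightarrow> 'a set \<Rightarrow> bool" where
  "invariant_set f L \<longleftrightarrow> f ` L = L"

(* Hyperbolicity is a property of compact invariant sets of C^1 maps only, so these
   standing conditions are part of the predicate; mind this when negating it. *)
definition hyperbolic_set :: "(real \<Rightarrow> real) \<Rightarrow> real set \<Rightarrow> bool" where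
  "hyperbolic_set f L \<longleftrightarrow>
     f C1_differentiable_on UNIV \<and> compact L \<and> invariant_set f L \<and>
     (\<exists>C>0. \<exists>l>1. \<forall>x\<in>L. \<forall>n\<ge>1. \<bar>deriv (f ^^ n) x\<bar> \<ge> C * l ^ n)"

definition Sigma2 :: "(nat \<Rightarrow> nat) set" where
  "Sigma2 = {s. \<forall>i. s i \<in> {1, 2}}"

definition Sigma2_dist :: "(nat \<Rightarrow> nat) \<Rightarrow> (nat \<Rightarrow> nat) \<Rightarrow> real" where
  "Sigma2_dist s t = (\<Sum>i. (if s i \<noteq> t i then 1 else 0) / 2 ^ i)"

lemma Sigma2_dist_summable:
  "summable (\<lambda>i. (if s i \<noteq> t i then 1 else 0) / 2 ^ i :: real)"
proof (rule summable_comparison_test'[where N = 0 and g = "\<lambda>i. (1 / 2) ^ i"])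
  show "summable (\<lambda>i. (1 / 2) ^ i :: real)" by (rule summable_geometric) simp
qed (auto simp: power_divide)

lemma Metric_space_Sigma2: "Metric_space Sigma2 Sigma2_dist"
proof
  fix s t u :: "nat \<Rightarrow> nat"
  show "0 \<le> Sigma2_dist s t"
    unfolding Sigma2_dist_def by (rule suminf_nonneg[OF Sigma2_dist_summable]) simp
  show "Sigma2_dist s t = Sigma2_dist t s"
    unfolding Sigma2_dist_def by (simp add: eq_commute)
  show "Sigma2_dist s t = 0 \<longleftrightarrow> s = t"
  proof -
    have "Sigma2_dist s t = 0 \<longleftrightarrow> (\<forall>i. (if s i \<noteq> t i then 1 else 0) / 2 ^ i = (0::real))"
      unfolding Sigma2_dist_def by (rule suminf_eq_zero_iff[OF Sigma2_dist_summable]) simp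
    then show ?thesis by (auto split: if_splits)
  qed
  show "Sigma2_dist s u \<le> Sigma2_dist s t + Sigma2_dist t u"
    unfolding Sigma2_dist_def
    by (subst suminf_add[OF Sigma2_dist_summable Sigma2_dist_summable],
        rule suminf_le[OF _ Sigma2_dist_summable
              summable_add[OF Sigma2_dist_summable Sigma2_dist_summable]])
       (auto simp: field_simps)
qed

definition Sigma2_top :: "(nat \<Rightarrow> nat) topology" where
  "Sigma2_top = Metric_space.mtopology Sigma2 Sigma2_dist"

lemma topspace_Sigma2_top: "topspace Sigma2_top = Sigma2"
  unfolding Sigma2_top_def by (rule Metric_space.topspace_mtopology[OF Metric_space_Sigma2])

definition shift :: "(nat \<Rightarrow> 'a) \<Rightarrow> nat \<Rightarrow> 'a" where
  "shift s = (\<lambda>i. s (Suc i))"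

definition top_semiconjugate ::
  "'a topology \<Rightarrow> ('a \<Rightarrow> 'a) \<Rightarrow> 'b topology \<Rightarrow> ('b \<Rightarrow> 'b) \<Rightarrow> bool" where
  "top_semiconjugate X f Y g \<longleftrightarrow>
     (\<exists>\<phi>. continuous_map X Y \<phi> \<and> \<phi> ` topspace X = topspace Y \<and>
          (\<forall>x\<in>topspace X. \<phi> (f x) = g (\<phi> x)))"

(* The map f_a = a g. *)
definition poly_family :: "real poly \<Rightarrow> real \<Rightarrow> real \<Rightarrow> real" where
  "poly_family g a x = a * poly g x"

(* The set Lambda_a, for f the map f_a. *)
definition survivor_set :: "(real \<Rightarrow> real) \<Rightarrow> real \<Rightarrow> real set" where
  "survivor_set f b = {x. \<forall>k. (f ^^ k) x \<in> {0..b}}"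

end

theory Submission
  imports Defs
begin

text \<open>
  Write \<open>f = a g\<close> and \<open>c = b / 2\<close>. The only thing that a large \<open>\<bar>a\<bar>\<close> has to achieve is
  \<open>f c > b\<close>. Since \<open>f 0 = f b = 0\<close>, the intermediate value theorem then shows that each of the
  two halves \<open>[0, c]\<close> and \<open>[c, b]\<close> is mapped over all of \<open>[0, b]\<close>, while \<open>c\<close> itself leaves
  \<open>[0, b]\<close> at once. So \<open>f\<close> is a topological horseshoe, and an orbit that stays in \<open>[0, b]\<close>
  has an unambiguous itinerary in the two symbols, which records the half that each iterate
  lies in. The itinerary is the semiconjugacy. Its coordinates are locally constant because
  the orbit avoids \<open>c\<close>, so it is continuous. It is onto because the points that follow
  a given itinerary for finitely many steps form a decreasing sequence of compact sets, nonempty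
  by repeated pullback along the two covering halves.

  The covering argument does not separate points with the same itinerary, so it gives a
  semiconjugacy rather than a conjugacy. The expansion that hyperbolicity asks for fails:
  \<open>b\<close> is sent to the fixed point \<open>0\<close> and hence belongs to the survivor set, and as a
  zero of \<open>g\<close> of order \<open>d2 \<ge> 2\<close> it is a critical point of \<open>f\<close>.
\<close>

section \<open>Continuity of maps into the sequence space\<close>

lemma Sigma2_dist_le_of_agree:
  assumes "\<And>i. i < n \<Longrightarrow> s i = t i"
  shows "Sigma2_dist s t \<le> 2 * (1 / 2) ^ n"
proof -
  let ?w = "\<lambda>i. (if s i \<noteq> t i then 1 else 0) / 2 ^ i :: real"
  have geo: "(\<lambda>i. (1 / 2) ^ n * (1 / 2) ^ i :: real) sums ((1 / 2) ^ n * 2)"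
    using sums_mult[OF geometric_sums[of "1 / 2 :: real"], of "(1 / 2) ^ n"] by simp
  have "Sigma2_dist s t = (\<Sum>i. ?w (i + n)) + (\<Sum>i<n. ?w i)"
    unfolding Sigma2_dist_def by (rule suminf_split_initial_segment[OF Sigma2_dist_summable])
  also have "(\<Sum>i<n. ?w i) = 0"
    using assms by (intro sum.neutral) auto
  also have "(\<Sum>i. ?w (i + n)) \<le> (\<Sum>i. (1 / 2) ^ n * (1 / 2) ^ i)"
  proof (rule suminf_le)
    show "?w (i + n) \<le> (1 / 2) ^ n * (1 / 2) ^ i" for i
      by (simp add: power_add power_divide mult.commute)
    show "summable (\<lambda>i. ?w (i + n))"
      using summable_ignore_initial_segment[OF Sigma2_dist_summable] .
  qed (use geo in \<open>rule sums_summable\<close>)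
  finally show ?thesis
    using sums_unique[OF geo] by simp
qed

text \<open>
  The metric induces the product topology of the discrete two-point space: fixing finitely many
  coordinates already confines a sequence to a small ball. Hence local constancy of every
  coordinate is enough for continuity.
\<close>

lemma continuous_map_into_Sigma2:
  assumes range: "\<And>x. x \<in> topspace X \<Longrightarrow> \<phi> x \<in> Sigma2"
    and loc: "\<And>x i. x \<in> topspace X \<Longrightarrow> openin X {y \<in> topspace X. \<phi> y i = \<phi> x i}"
  shows "continuous_map X Sigma2_top \<phi>"
proof -
  interpret Metric_space Sigma2 Sigma2_dist
    by (rule Metric_space_Sigma2)
  have "\<exists>U. openin X U \<and> x \<in> U \<and> (\<forall>y\<in>U. \<phi> y \<in> mball (\<phi> x) e)"
    if x: "x \<in> topspace X" and e: "e > 0" for x e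
  proof -
    obtain n where n: "(1 / 2) ^ n < e / 2"
      using real_arch_pow_inv[of "e / 2" "1 / 2"] e by auto
    let ?U = "topspace X \<inter> (\<Inter>i<n. {y \<in> topspace X. \<phi> y i = \<phi> x i})"
    have "openin X ?U"
    proof (cases "n = 0")
      case False
      then show ?thesis
        by (intro openin_Int openin_topspace openin_INT2) (auto intro: loc[OF x])
    qed simp
    moreover have "\<phi> y \<in> mball (\<phi> x) e" if y: "y \<in> ?U" for y
    proof -
      have "Sigma2_dist (\<phi> x) (\<phi> y) \<le> 2 * (1 / 2) ^ n"
        using y by (intro Sigma2_dist_le_of_agree) auto
      then show ?thesis
        using n x y range by (auto simp: in_mball)
    qed
    ultimately show ?thesis
      using x by (intro exI[of _ ?U]) blast
  qed
  then show ?thesis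
    unfolding Sigma2_top_def by (auto simp: continuous_map_to_metric)
qed

section \<open>Topological horseshoes on an interval\<close>

locale horseshoe =
  fixes f :: "real \<Rightarrow> real" and b c :: real
  assumes cont: "continuous_on UNIV f"
    and ends: "f 0 = 0" "f b = 0"
    and c_inside: "0 < c" "c < b"
    and c_escapes: "b < f c"
begin

lemma continuous_iterate: "continuous_on UNIV (f ^^ k)"
proof (induction k)
  case (Suc k)
  then show ?case
    using continuous_on_compose2[OF cont Suc] by simp
qed (simp add: id_def)

lemma survivor_iterate:
  assumes "x \<in> survivor_set f b"
  shows "(f ^^ k) x \<in> survivor_set f b"
proof -
  have "(f ^^ j) ((f ^^ k) x) \<in> {0..b}" for j
    using assms unfolding survivor_set_def funpow_add[THEN fun_cong, unfolded o_apply, symmetric]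
    by blast
  then show ?thesis
    by (simp add: survivor_set_def)
qed

lemma survivor_subset: "survivor_set f b \<subseteq> {0..b}"
  using funpow_0[of f] unfolding survivor_set_def by (metis (mono_tags) mem_Collect_eq subsetI)

lemma survivor_neq_c: "x \<in> survivor_set f b \<Longrightarrow> x \<noteq> c"
  using survivor_iterate[of x 1] survivor_subset c_escapes by auto

lemma survivor_if_image:
  assumes "x \<in> {0..b}" "f x \<in> survivor_set f b"
  shows "x \<in> survivor_set f b"
proof -
  have "(f ^^ k) x \<in> {0..b}" for k
    using assms by (cases k)
      (auto simp: survivor_set_def funpow_Suc_right simp del: funpow.simps(2))
  then show ?thesis
    by (simp add: survivor_set_def)
qed

lemma zero_survives: "0 \<in> survivor_set f b"
proof -
  have "(f ^^ k) 0 = 0" for k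
    by (induction k) (auto simp: ends)
  then show ?thesis
    using c_inside by (auto simp: survivor_set_def)
qed

lemma b_survives: "b \<in> survivor_set f b"
  using survivor_if_image[of b] zero_survives ends c_inside by auto

lemma compact_survivor: "compact (survivor_set f b)"
proof -
  have "survivor_set f b = {0..b} \<inter> (\<Inter>k. (f ^^ k) -` {0..b})"
    using survivor_subset by (auto simp: survivor_set_def)
  moreover have "closed ((f ^^ k) -` {0..b})" for k
    using continuous_iterate by (intro closed_vimage) (auto simp: continuous_on_eq_continuous_within)
  ultimately show ?thesis
    by (simp add: compact_Int_closed closed_INT)
qed

definition half :: "nat \<Rightarrow> real set" where
  "half j = (if j = 1 then {0..c} else {c..b})"

lemma half_subset: "half j \<subseteq> {0..b}"
  using c_inside by (auto simp: half_def)

lemma half_covers: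
  assumes "y \<in> {0..b}"
  obtains x where "x \<in> half j" "f x = y"
proof (cases "j = 1")
  case True
  have "\<exists>x\<ge>0. x \<le> c \<and> f x = y"
    using assms ends c_inside c_escapes
    by (intro IVT' continuous_on_subset[OF cont]) auto
  then show ?thesis
    using that True by (auto simp: half_def)
next
  case False
  have "\<exists>x\<ge>c. x \<le> b \<and> f x = y"
    using assms ends c_inside c_escapes
    by (intro IVT2' continuous_on_subset[OF cont]) auto
  then show ?thesis
    using that False by (auto simp: half_def)
qed

lemma invariant_survivor: "invariant_set f (survivor_set f b)"
  unfolding invariant_set_def
proof
  show "f ` survivor_set f b \<subseteq> survivor_set f b"
    using survivor_iterate[of _ 1] by auto
  show "survivor_set f b \<subseteq> f ` survivor_set f b"
  proof
    fix y assume y: "y \<in> survivor_set f b"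
    then obtain x where "x \<in> half 1" "f x = y"
      using half_covers survivor_subset by blast
    then show "y \<in> f ` survivor_set f b"
      using y survivor_if_image half_subset by blast
  qed
qed

text \<open>
  The induction is over all itineraries at once, so that it applies to the shifted one: a point that follows the
  tail of the itinerary is pulled back once into the half named by the first symbol.
\<close>

lemma finite_itinerary_realised: "\<exists>x\<in>{0..b}. \<forall>i<n. (f ^^ i) x \<in> half (s i)"
proof (induction n arbitrary: s)
  case 0
  then show ?case
    using c_inside by (intro bexI[of _ 0]) auto
next
  case (Suc n)
  obtain y where y: "y \<in> {0..b}" "\<And>i. i < n \<Longrightarrow> (f ^^ i) y \<in> half (shift s i)"
    using Suc[of "shift s"] by blast
  obtain x where x: "x \<in> half (s 0)" "f x = y"
    using half_covers[OF y(1)] .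
  have "(f ^^ i) x \<in> half (s i)" if "i < Suc n" for i
    using that x y(2)
    by (cases i) (auto simp: shift_def funpow_Suc_right simp del: funpow.simps(2))
  then show ?case
    using x half_subset by blast
qed

lemma itinerary_realised:
  obtains x where "x \<in> survivor_set f b" "\<And>i. (f ^^ i) x \<in> half (s i)"
proof -
  define K where "K n = {0..b} \<inter> (\<Inter>i<n. (f ^^ i) -` half (s i))" for n
  have "closed ((f ^^ i) -` half (s i))" for i
    using continuous_iterate
    by (intro closed_vimage) (auto simp: continuous_on_eq_continuous_within half_def)
  then have "compact (K n)" for n
    unfolding K_def by (intro compact_Int_closed) auto
  moreover have "K n \<noteq> {}" for n
    using finite_itinerary_realised[of n s] by (auto simp: K_def)
  moreover have "K n \<subseteq> K m" if "m \<le> n" for m n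
    using that by (auto simp: K_def)
  ultimately have "(\<Inter>n. K n) \<noteq> {}"
    using compact_nest[of K] by auto
  then obtain x where "\<And>n. x \<in> K n"
    by auto
  then have x: "(f ^^ i) x \<in> half (s i)" for i
    unfolding K_def by blast
  then have "x \<in> survivor_set f b"
    using half_subset by (fastforce simp: survivor_set_def)
  then show thesis
    using x that by blast
qed

definition itinerary :: "real \<Rightarrow> nat \<Rightarrow> nat" where
  "itinerary x i = (if (f ^^ i) x < c then 1 else 2)"

lemma itinerary_eqI:
  assumes x: "x \<in> survivor_set f b" and s: "s \<in> Sigma2"
    and half: "\<And>i. (f ^^ i) x \<in> half (s i)"
  shows "itinerary x = s"
proof
  fix i
  have "(f ^^ i) x \<noteq> c"
    using survivor_iterate[OF x] by (rule survivor_neq_c)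
  moreover have "s i = 1 \<or> s i = 2"
    using s by (auto simp: Sigma2_def)
  ultimately show "itinerary x i = s i"
    using half[of i] by (auto simp: itinerary_def half_def)
qed

text \<open>
  Both \<open>f\<^sup>i x < c\<close> and \<open>f\<^sup>i x > c\<close> are open conditions, and they exhaust the survivor set because
  no surviving orbit meets \<open>c\<close>.
\<close>

lemma continuous_itinerary: "continuous_map (top_of_set (survivor_set f b)) Sigma2_top itinerary"
proof (rule continuous_map_into_Sigma2)
  fix x i assume "x \<in> topspace (top_of_set (survivor_set f b))"
  let ?L = "survivor_set f b"
  have neq: "(f ^^ i) y \<noteq> c" if "y \<in> ?L" for y
    using survivor_iterate[OF that] by (rule survivor_neq_c)
  define W where "W = (if itinerary x i = 1 then {..<c} else {c<..})"
  have "open ((f ^^ i) -` W)"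
    using continuous_iterate
    by (intro open_vimage) (auto simp: W_def)
  moreover have "itinerary y i = itinerary x i \<longleftrightarrow> (f ^^ i) y \<in> W" if "y \<in> ?L" for y
    using neq[OF that] by (auto simp: W_def itinerary_def)
  then have "{y \<in> ?L. itinerary y i = itinerary x i} = ?L \<inter> (f ^^ i) -` W"
    by auto
  ultimately show "openin (top_of_set ?L)
      {y \<in> topspace (top_of_set ?L). itinerary y i = itinerary x i}"
    by (simp add: openin_open_Int)
qed (simp add: Sigma2_def itinerary_def)

lemma semiconjugate_to_shift:
  "top_semiconjugate (top_of_set (survivor_set f b)) f Sigma2_top shift"
  unfolding top_semiconjugate_def topspace_Sigma2_top topspace_euclidean_subtopology
proof (intro exI[of _ itinerary] conjI ballI)
  show "itinerary ` survivor_set f b = Sigma2"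
  proof
    show "itinerary ` survivor_set f b \<subseteq> Sigma2"
      by (auto simp: Sigma2_def itinerary_def split: if_splits)
    show "Sigma2 \<subseteq> itinerary ` survivor_set f b"
    proof
      fix s assume "s \<in> Sigma2"
      moreover obtain x where "x \<in> survivor_set f b" "\<And>i. (f ^^ i) x \<in> half (s i)"
        using itinerary_realised[of s] by blast
      ultimately show "s \<in> itinerary ` survivor_set f b"
        using itinerary_eqI by blast
    qed
  qed
  show "itinerary (f x) = shift (itinerary x)" for x
    by (rule ext) (simp add: itinerary_def shift_def funpow_swap1)
qed (rule continuous_itinerary)

end

section \<open>The polynomial family\<close>

lemma not_hyperbolic_if_critical_point:
  assumes "x \<in> L" "deriv f x = 0"
  shows "\<not> hyperbolic_set f L"
proof
  assume "hyperbolic_set f L"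
  then obtain C l :: real where "C > 0" "l > 1" and
    exp: "\<And>n. n \<ge> 1 \<Longrightarrow> C * l ^ n \<le> \<bar>deriv (f ^^ n) x\<bar>"
    using assms(1) unfolding hyperbolic_set_def by blast
  have "C * l \<le> 0"
    using exp[of 1] assms(2) by simp
  moreover have "0 < C * l"
    using \<open>C > 0\<close> \<open>l > 1\<close> by simp
  ultimately show False
    by simp
qed

lemma deriv_poly_family_multiple_root:
  assumes "2 \<le> order x g"
  shows "deriv (poly_family g a) x = 0"
proof -
  have "[:- x, 1:] ^ 2 dvd g"
    using assms by (meson order_1 power_le_dvd)
  then obtain q where q: "g = [:- x, 1:] ^ 2 * q"
    by blast
  have "poly (pderiv g) x = 0"
    unfolding q pderiv_mult by (simp add: power2_eq_square pderiv_mult pderiv_pCons)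
  moreover have "(poly_family g a has_field_derivative a * poly (pderiv g) x) (at x)"
    unfolding poly_family_def by (intro DERIV_cmult poly_DERIV)
  ultimately show ?thesis
    using DERIV_imp_deriv by fastforce
qed

theorem theorem3p3:
  fixes g h :: "real poly" and b :: real and d1 d2 :: nat
  assumes "lead_coeff g = 1"
    and "poly g 0 = 0" and "order 0 g = d1"
    and "b > 0" and "poly g b = 0" and "\<forall>x. 0 < x \<and> x < b \<longrightarrow> poly g x \<noteq> 0"
    and "order b g = d2"
    and "g = [:0, 1:] ^ d1 * [:b, -1:] ^ d2 * h"
    and "\<forall>x\<in>{0..b}. poly h x \<noteq> 0"
    and "d1 = 1" and "d2 > d1"
  shows "\<exists>N>0. \<forall>a::real. \<bar>a\<bar> > N \<and> (\<forall>x\<in>{0..b}. a * poly h x > 0) \<longrightarrow>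
    (let f = poly_family g a; L = survivor_set f b in
       compact L \<and> invariant_set f L \<and>
       top_semiconjugate (top_of_set L) f Sigma2_top shift \<and>
       \<not> hyperbolic_set f L)"
proof -
  define c where "c = b / 2"
  have c: "0 < c" "c < b"
    using \<open>b > 0\<close> by (auto simp: c_def)
  have gc: "\<bar>poly g c\<bar> > 0"
    using assms(6) c by simp
  \<comment> \<open>Beyond this bound the value at the midpoint exceeds \<open>b\<close> in modulus;
    its sign is that of \<open>a h(c)\<close>.\<close>
  define N where "N = b / \<bar>poly g c\<bar>"
  have "N > 0"
    using gc \<open>b > 0\<close> by (simp add: N_def)
  moreover have "compact (survivor_set (poly_family g a) b) \<and>
      invariant_set (poly_family g a) (survivor_set (poly_family g a) b) \<and>
      top_semiconjugate (top_of_set (survivor_set (poly_family g a) b)) (poly_family g a)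
        Sigma2_top shift \<and>
      \<not> hyperbolic_set (poly_family g a) (survivor_set (poly_family g a) b)"
    if a: "\<bar>a\<bar> > N" and pos: "\<forall>x\<in>{0..b}. a * poly h x > 0" for a
  proof -
    have "a * poly g c = c ^ d1 * (b - c) ^ d2 * (a * poly h c)"
      by (subst assms(8)) (simp add: poly_power)
    also have "\<dots> > 0"
      using pos c by simp
    finally have "a * poly g c = \<bar>a\<bar> * \<bar>poly g c\<bar>"
      by (simp add: abs_mult[symmetric])
    also have "\<dots> > b"
      using a gc by (simp add: N_def field_simps)
    finally have "poly_family g a c > b"
      by (simp add: poly_family_def)
    then interpret horseshoe "poly_family g a" b c
      by unfold_locales
        (use c assms(2,5) in \<open>auto simp: poly_family_def intro!: continuous_intros\<close>)
    have "deriv (poly_family g a) b = 0"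
      using assms(7,10,11) by (intro deriv_poly_family_multiple_root) simp
    then show ?thesis
      using compact_survivor invariant_survivor semiconjugate_to_shift
        not_hyperbolic_if_critical_point[OF b_survives] by blast
  qed
  ultimately show ?thesis
    unfolding Let_def by blast
qed

end
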